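(* Let $n\ge3$ and let $C_n$ be the cycle with vertex set $\{1,\ldots,n\}$ and edges $(1,2),(2,3),\ldots,(n-1,n),(n,1)$. Then the total number of spanning rooted forests of $C_n$ is $f=\mathcal F_{2n-1}+\mathcal F_{2n+1}-2$, and for all $i,j\in\{1,\ldots,n\}$, $$f_{ij}=\mathcal F_{2|j-i|}+\mathcal F_{2n-2|j-i|}.$$
   Context: $(\mathcal F_k)_{k\ge0}$ denotes the Fibonacci numbers: $\mathcal F_0=0$, $\mathcal F_1=1$, $\mathcal F_{k+2}=\mathcal F_{k+1}+\mathcal F_k$. A spanning rooted forest of a graph $G$ is a spanning acyclic subgraph of $G$ in which exactly one vertex (the root) is marked in each tree. $f_{ij}$ is the number of spanning rooted forests in which $i$ and $j$ lie in the same tree and that tree is rooted at $i$; $f$ is the total number of spanning rooted forests. *)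

theory Defs
  imports "HOL-Number_Theory.Fib"
begin

text \<open>
  A finite simple graph is given by its vertex set \<open>V\<close> and a set \<open>E\<close> of two-element subsets of
  \<open>V\<close>. The symmetric digraphs of the AFP entry Graph\_Theory are not used, because there every
  edge traversed back and forth counts as a cycle.
\<close>

text \<open>A cycle is listed by its vertices, without repeating the starting point.\<close>

definition ucycle :: "'a set set \<Rightarrow> 'a list \<Rightarrow> bool" where
  "ucycle E xs \<longleftrightarrow> 3 \<le> length xs \<and> distinct xs \<and>
     (\<forall>k < length xs. {xs ! k, xs ! (Suc k mod length xs)} \<in> E)"

definition uacyclic :: "'a set set \<Rightarrow> bool" where
  "uacyclic E \<longleftrightarrow> (\<nexists>xs. ucycle E xs)"

definition connected_rel :: "'a set \<Rightarrow> 'a set set \<Rightarrow> ('a \<times> 'a) set" where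
  "connected_rel V E = {(u, v). {u, v} \<in> E}\<^sup>* \<inter> V \<times> V"

definition components :: "'a set \<Rightarrow> 'a set set \<Rightarrow> 'a set set" where
  "components V E = V // connected_rel V E"

text \<open>
  A spanning subgraph has vertex set \<open>V\<close>, so it is determined by its edge set \<open>F\<close>. When \<open>F\<close> is
  acyclic, the components of \<open>(V, F)\<close> are the vertex sets of the trees of the forest. The set \<open>R\<close>
  consists of the marked vertices.
\<close>

definition spanning_rooted_forests :: "'a set \<Rightarrow> 'a set set \<Rightarrow> ('a set set \<times> 'a set) set" where
  "spanning_rooted_forests V E =
     {(F, R). F \<subseteq> E \<and> uacyclic F \<and> R \<subseteq> V \<and> (\<forall>T \<in> components V F. \<exists>!r. r \<in> T \<and> r \<in> R)}"

definition num_forests :: "'a set \<Rightarrow> 'a set set \<Rightarrow> nat" where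
  "num_forests V E = card (spanning_rooted_forests V E)"

definition num_forests_rooted :: "'a set \<Rightarrow> 'a set set \<Rightarrow> 'a \<Rightarrow> 'a \<Rightarrow> nat" where
  "num_forests_rooted V E i j =
     card {(F, R). (F, R) \<in> spanning_rooted_forests V E \<and>
                   (\<exists>T \<in> components V F. i \<in> T \<and> j \<in> T \<and> i \<in> R)}"

definition cycle_verts :: "nat \<Rightarrow> nat set" where
  "cycle_verts n = {1..n}"

definition cycle_edges :: "nat \<Rightarrow> nat set set" where
  "cycle_edges n = {{k, k + 1} |k. 1 \<le> k \<and> k < n} \<union> {{n, 1}}"

end

theory Submission
  imports Defs
begin

text \<open>
  Go round the cycle past vertex 1, edge 1, vertex 2, edge 2, and so on, and mark the roots and the
  deleted edges. A subgraph with chosen roots is a rooted forest iff something is marked and the two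
  kinds of marks alternate. Before each of these \<open>2 n\<close> objects record whether the last mark passed
  was a root, and negate the record at every other place. Since a root can only follow a deleted edge
  and vice versa, the result is a cyclic word of length \<open>2 n\<close> without two adjacent ones, the marked
  objects are those lying between two zeros, and only the two words without adjacent zeros do not
  come from a forest. Such words are counted by the Lucas number
  \<open>fib (2 n + 1) + fib (2 n - 1)\<close>. Requiring that \<open>i\<close> is a root and that one of the two arcs from
  \<open>i\<close> to \<open>j\<close> has no deleted edge fixes the word along this arc and leaves a linear word of the other
  positions, which is counted by a Fibonacci number.
\<close>

section \<open>Sparse words\<close>

definition sparse_sets :: "nat \<Rightarrow> nat set set" where
  "sparse_sets m = {A. A \<subseteq> {..<m} \<and> (\<forall>k. \<not> (k \<in> A \<and> Suc k \<in> A))}"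

lemma finite_sparse_sets: "finite (sparse_sets m)"
  by (rule finite_subset[of _ "Pow {..<m}"]) (auto simp: sparse_sets_def)

text \<open>The Fibonacci recursion comes from the largest admissible position \<open>Suc m\<close>:
  if it is absent, a set for \<open>Suc m\<close> remains; if it is present, \<open>m\<close> is
  absent and removing \<open>Suc m\<close> leaves a set for \<open>m\<close>.\<close>

lemma card_sparse_sets: "card (sparse_sets m) = fib (m + 2)"
proof (induction m rule: fib.induct)
  case 1
  have "sparse_sets 0 = {{}}" by (auto simp: sparse_sets_def)
  then show ?case by simp
next
  case 2
  have "sparse_sets (Suc 0) = {{}, {0}}" by (auto simp: sparse_sets_def)
  then show ?case by (simp add: numeral_eq_Suc)
next
  case (3 m)
  have split: "sparse_sets (Suc (Suc m)) = sparse_sets (Suc m) \<union> insert (Suc m) ` sparse_sets m"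
    (is "?L = ?R")
  proof
    show "?L \<subseteq> ?R"
    proof
      fix A assume A: "A \<in> ?L"
      show "A \<in> ?R"
      proof (cases "Suc m \<in> A")
        case True
        with A have "m \<notin> A" by (auto simp: sparse_sets_def)
        with A have "A - {Suc m} \<in> sparse_sets m"
          by (auto simp: sparse_sets_def less_Suc_eq)
        moreover have "A = insert (Suc m) (A - {Suc m})" using True by auto
        ultimately show ?thesis by blast
      next
        case False
        with A show ?thesis by (auto simp: sparse_sets_def less_Suc_eq)
      qed
    qed
    show "?R \<subseteq> ?L" by (auto simp: sparse_sets_def)
  qed
  have inj: "inj_on (insert (Suc m)) (sparse_sets m)"
  proof (rule inj_onI)
    fix A B assume "A \<in> sparse_sets m" "B \<in> sparse_sets m" "insert (Suc m) A = insert (Suc m) B"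
    moreover from this have "Suc m \<notin> A" "Suc m \<notin> B" by (auto simp: sparse_sets_def)
    ultimately show "A = B" by (simp add: insert_ident)
  qed
  have disj: "sparse_sets (Suc m) \<inter> insert (Suc m) ` sparse_sets m = {}"
    by (auto simp: sparse_sets_def)
  show ?case
    using 3 unfolding split
    by (simp add: card_Un_disjoint finite_sparse_sets disj card_image inj)
qed

section \<open>Cyclic words, extended periodically to the integers\<close>

definition sparse_necklaces :: "nat \<Rightarrow> (int \<Rightarrow> bool) set" where
  "sparse_necklaces N = {s. (\<forall>x. s (x + int N) = s x) \<and> (\<forall>x. \<not> (s x \<and> s (x + 1)))}"

text \<open>The index \<open>x\<close> stands for the object between the positions \<open>x\<close>
  and \<open>x + 1\<close> of the word; a zero on either side of it means that it is marked.\<close>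

definition gap :: "(int \<Rightarrow> bool) \<Rightarrow> int \<Rightarrow> bool" where
  "gap s x \<longleftrightarrow> \<not> s x \<and> \<not> s (x + 1)"

lemma sparse_necklaceD: "s \<in> sparse_necklaces N \<Longrightarrow> s x \<Longrightarrow> \<not> s (x + 1)"
  by (auto simp: sparse_necklaces_def)

lemma periodic_mult:
  fixes s :: "int \<Rightarrow> 'a"
  assumes "\<And>x. s (x + p) = s x"
  shows "s (x + p * q) = s x"
proof -
  have nat: "s (x + p * int k) = s x" for x k
  proof (induction k)
    case (Suc k)
    have "s (x + p * int (Suc k)) = s ((x + p * int k) + p)" by (simp add: algebra_simps)
    with Suc show ?case by (simp only: assms)
  qed simp
  show ?thesis
  proof (cases "q \<ge> 0")
    case True
    then show ?thesis using nat[of x "nat q"] by simp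
  next
    case False
    then show ?thesis using nat[of "x + p * q" "nat (- q)"] by simp
  qed
qed

lemma necklace_mult: "s \<in> sparse_necklaces N \<Longrightarrow> s (x + int N * q) = s x"
  by (rule periodic_mult) (simp add: sparse_necklaces_def)

lemma necklace_mod: "s \<in> sparse_necklaces N \<Longrightarrow> s (c + (x - c) mod int N) = s x"
  using necklace_mult[of s N "c + (x - c) mod int N" "(x - c) div int N"]
  by (simp add: mod_mult_div_eq add.assoc)

text \<open>Since the prescribed window begins and ends with a zero, it imposes nothing on its
  neighbours. Cutting it out leaves an arbitrary linear word on the other \<open>N - l\<close>
  positions.\<close>

lemma card_necklaces_prescribed:
  assumes l: "0 < l" "l \<le> N" and ends: "\<not> p 0" "\<not> p (l - 1)"
    and p: "\<And>r. Suc r < l \<Longrightarrow> \<not> (p r \<and> p (Suc r))"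
  shows "card {s \<in> sparse_necklaces N. \<forall>x<l. s (c + int x) = p x} = fib (N - l + 2)"
    and "finite {s \<in> sparse_necklaces N. \<forall>x<l. s (c + int x) = p x}"
proof -
  let ?S = "{s \<in> sparse_necklaces N. \<forall>x<l. s (c + int x) = p x}"
  \<comment> \<open>\<open>f\<close> reads off the ones outside the window. Its inverse
    \<open>g\<close> writes one period, \<open>h A\<close>, starting at \<open>c\<close>, and
    repeats it.\<close>
  define f :: "(int \<Rightarrow> bool) \<Rightarrow> nat set" where "f s = {k. k < N - l \<and> s (c + int (l + k))}" for s
  define h :: "nat set \<Rightarrow> nat \<Rightarrow> bool" where "h A r = (if r < l then p r else r - l \<in> A)" for A r
  define g :: "nat set \<Rightarrow> int \<Rightarrow> bool" where "g A x = h A (nat ((x - c) mod int N))" for A x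
  have N: "0 < N" using l by simp
  have bij: "bij_betw f ?S (sparse_sets (N - l))"
  proof (rule bij_betw_byWitness[where f' = g])
    show "\<forall>s\<in>?S. g (f s) = s"
    proof (intro ballI ext)
      fix s x assume s: "s \<in> ?S"
      define r where "r = nat ((x - c) mod int N)"
      have r: "r < N" "int r = (x - c) mod int N" using N by (auto simp: r_def nat_less_iff)
      have "s x = s (c + int r)" using s r by (simp add: necklace_mod)
      then show "g (f s) x = s x"
        using s r(1) by (auto simp: g_def h_def f_def r_def[symmetric])
    qed
    show "\<forall>A\<in>sparse_sets (N - l). f (g A) = A"
    proof
      fix A assume A: "A \<in> sparse_sets (N - l)"
      have "g A (c + int (l + k)) \<longleftrightarrow> k \<in> A" if "k < N - l" for k
        using that by (simp add: g_def h_def flip: of_nat_add of_nat_mod)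
      then show "f (g A) = A" using A by (auto simp: f_def sparse_sets_def)
    qed
    show "f ` ?S \<subseteq> sparse_sets (N - l)"
      by (auto simp: f_def sparse_sets_def sparse_necklaces_def algebra_simps)
    show "g ` sparse_sets (N - l) \<subseteq> ?S"
    proof (rule image_subsetI)
      fix A assume A: "A \<in> sparse_sets (N - l)"
      have "g A (x + int N) = g A x" for x
        by (simp add: g_def flip: diff_add_eq)
      moreover have "\<not> (g A x \<and> g A (x + 1))" for x
      proof -
        define r where "r = nat ((x - c) mod int N)"
        have r: "r < N" "int r = (x - c) mod int N" using N by (auto simp: r_def nat_less_iff)
        have "(x + 1 - c) mod int N = (int r + 1) mod int N"
          unfolding r(2) mod_add_left_eq by (simp add: algebra_simps)
        also have "\<dots> = int (Suc r mod N)" by (simp add: of_nat_mod algebra_simps)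
        finally have g: "g A x = h A r" "g A (x + 1) = h A (Suc r mod N)"
          by (simp_all add: g_def r_def)
        \<comment> \<open>The pair \<open>r\<close>, \<open>Suc r\<close> crosses the end of the
          period, lies inside the window, leaves the window, or lies in the free part. The zeros at
          the two ends of the window settle the first and the third case.\<close>
        consider "Suc r = N" | "Suc r < N" "Suc r < l" | "Suc r < N" "Suc r = l"
          | "Suc r < N" "l \<le> r"
          using r(1) by linarith
        then show ?thesis
        proof cases
          case 4
          then show ?thesis using A unfolding g
            by (auto simp: h_def sparse_sets_def Suc_diff_le)
        qed (use ends p l in \<open>auto simp: g h_def\<close>)
      qed
      moreover have "g A (c + int x) = p x" if "x < l" for x
        using that l by (simp add: g_def h_def flip: of_nat_mod)
      ultimately show "g A \<in> ?S" by (simp add: sparse_necklaces_def)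
    qed
  qed
  show "card ?S = fib (N - l + 2)"
    using bij_betw_same_card[OF bij] by (simp only: card_sparse_sets)
  show "finite ?S" using bij_betw_finite[OF bij] by (simp add: finite_sparse_sets)
qed

text \<open>Split by the value at 0. A zero there is a window of length 1; a one forces zeros on
  both sides, which is the window 0 1 0 of length 3 starting at -1.\<close>

lemma card_sparse_necklaces:
  assumes "N \<ge> 3"
  shows "card (sparse_necklaces N) = fib (N + 1) + fib (N - 1)" "finite (sparse_necklaces N)"
proof -
  let ?A = "{s \<in> sparse_necklaces N. \<forall>x<1. s (0 + int x) = False}"
  let ?B = "{s \<in> sparse_necklaces N. \<forall>x<3. s (- 1 + int x) = (x = 1)}"
  have A: "card ?A = fib (N - 1 + 2)" "finite ?A"
    by (rule card_necklaces_prescribed[where p = "\<lambda>_. False"]; use assms in simp)+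
  have B: "card ?B = fib (N - 3 + 2)" "finite ?B"
    by (rule card_necklaces_prescribed[where p = "\<lambda>x. x = 1"]; use assms in simp)+
  have B': "?B = {s \<in> sparse_necklaces N. s 0}"
  proof (intro Collect_cong conj_cong refl)
    fix s assume "s \<in> sparse_necklaces N"
    then show "(\<forall>x<3. s (- 1 + int x) = (x = 1)) \<longleftrightarrow> s 0"
      using sparse_necklaceD[of s N "-1"] sparse_necklaceD[of s N 0]
      by (auto simp: numeral_3_eq_3 All_less_Suc)
  qed
  have split: "sparse_necklaces N = ?A \<union> ?B" and "?A \<inter> ?B = {}" unfolding B' by auto
  then have "card (sparse_necklaces N) = card ?A + card ?B"
    using card_Un_disjoint[OF A(2) B(2)] by simp
  moreover have "N - 1 + 2 = N + 1" "N - 3 + 2 = N - 1" using assms by auto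
  ultimately show "card (sparse_necklaces N) = fib (N + 1) + fib (N - 1)"
    unfolding A B by (simp only:)
  show "finite (sparse_necklaces N)"
    using A(2) B(2) by (subst split) (rule finite_UnI)
qed

definition gapped_necklaces :: "nat \<Rightarrow> (int \<Rightarrow> bool) set" where
  "gapped_necklaces N = {s \<in> sparse_necklaces N. \<exists>x. gap s x}"

lemma alternating_even:
  fixes s :: "int \<Rightarrow> bool"
  assumes "\<And>x. s (x + 1) \<longleftrightarrow> \<not> s x"
  shows "s x \<longleftrightarrow> (even x \<longleftrightarrow> s 0)"
proof -
  have p: "s (x + 2) = s x" for x
    using assms[of x] assms[of "x + 1"] by (simp add: add.commute)
  have "s (2 * k) = s 0" for k using periodic_mult[of s 2 0 k] p by simp
  moreover from this have "s (2 * k + 1) \<longleftrightarrow> \<not> s 0" for k using assms[of "2 * k"] by simp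
  ultimately show ?thesis by (cases "even x") (auto elim!: evenE oddE)
qed

text \<open>A word without adjacent ones and without adjacent zeros alternates strictly, so it is
  one of the predicates \<open>even\<close> and \<open>odd\<close>. Both have period
  \<open>N\<close> because \<open>N\<close> is even.\<close>

lemma card_gapped_necklaces:
  assumes "N \<ge> 3" "even N"
  shows "card (gapped_necklaces N) + 2 = fib (N + 1) + fib (N - 1)"
proof -
  have eq: "sparse_necklaces N = gapped_necklaces N \<union> {even, odd}"
  proof (intro equalityI subsetI)
    fix s assume s: "s \<in> sparse_necklaces N"
    show "s \<in> gapped_necklaces N \<union> {even, odd}"
    proof (cases "\<exists>x. gap s x")
      case False
      then have "s (x + 1) \<longleftrightarrow> \<not> s x" for x
        using s by (auto simp: gap_def sparse_necklaces_def)
      from alternating_even[where s = s, OF this] have "s x \<longleftrightarrow> (even x \<longleftrightarrow> s 0)" for x .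
      then have "s = even \<or> s = odd" by (cases "s 0") (auto simp: fun_eq_iff)
      then show ?thesis by auto
    qed (use s in \<open>auto simp: gapped_necklaces_def\<close>)
  qed (use assms in \<open>auto simp: gapped_necklaces_def sparse_necklaces_def\<close>)
  have disj: "gapped_necklaces N \<inter> {even, odd} = {}"
    by (auto simp: gapped_necklaces_def gap_def)
  have "(even :: int \<Rightarrow> bool) \<noteq> odd" by (metis even_zero)
  then have "card {even :: int \<Rightarrow> bool, odd} = 2" by simp
  then have "card (sparse_necklaces N) = card (gapped_necklaces N) + 2"
    using card_Un_disjoint[OF _ _ disj] card_sparse_necklaces(2)[OF assms(1)] unfolding eq by simp
  then show ?thesis using card_sparse_necklaces(1)[OF assms(1)] by simp
qed

text \<open>Objects at odd distance from \<open>c\<close> are of the other kind than the one at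
  \<open>c\<close>. While none of them is marked, each zero at an odd offset must be followed by a
  one, and that one by a zero, so the word reads 0 0 1 0 1 0 and so on from
  \<open>c\<close>.\<close>

lemma gap_run_iff:
  assumes s: "s \<in> sparse_necklaces N" and c: "gap s c"
  shows "(\<forall>r<d. \<not> gap s (c + 2 * int r + 1)) \<longleftrightarrow> (\<forall>x<2 * d + 2. s (c + int x) = (even x \<and> x \<noteq> 0))"
proof (induction d)
  case 0
  then show ?case using c by (auto simp: gap_def numeral_2_eq_2 less_Suc_eq)
next
  case (Suc d)
  have *: "(\<forall>x<2 * Suc d + 2. P x) \<longleftrightarrow> (\<forall>x<2 * d + 2. P x) \<and> P (2 * d + 2) \<and> P (2 * d + 3)" for P
    by (auto simp: numeral_eq_Suc less_Suc_eq)
  have "\<not> gap s (c + 2 * int d + 1) \<longleftrightarrow> s (c + int (2 * d + 2)) \<and> \<not> s (c + int (2 * d + 3))"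
    if "\<forall>x<2 * d + 2. s (c + int x) = (even x \<and> x \<noteq> 0)"
  proof -
    have "\<not> s (c + int (2 * d + 1))" using that[rule_format, of "2 * d + 1"] by simp
    then show ?thesis using sparse_necklaceD[OF s, of "c + int (2 * d + 2)"]
      by (auto simp: gap_def algebra_simps)
  qed
  then show ?case unfolding * All_less_Suc Suc by auto
qed

text \<open>Otherwise the forced pattern of \<open>gap_run_iff\<close> would extend over a full turn
  and put a one at \<open>c + 2 * n\<close>, where periodicity demands the zero at \<open>c\<close>.
  This is how a mark of one kind yields a mark of the other kind.\<close>

lemma next_odd_gap:
  assumes s: "s \<in> sparse_necklaces (2 * n)" and c: "gap s c" and n: "0 < n"
  shows "\<exists>r<n. gap s (c + 2 * int r + 1)"
proof (rule ccontr)
  assume "\<not> ?thesis"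
  then have "\<forall>x<2 * n + 2. s (c + int x) = (even x \<and> x \<noteq> 0)" using gap_run_iff[OF s c] by blast
  then have "s (c + int (2 * n))" using n by (simp del: of_nat_mult)
  moreover have "s (c + int (2 * n)) = s c" using necklace_mult[OF s, of c 1] by simp
  ultimately show False using c by (simp add: gap_def)
qed

lemma card_gap_run:
  assumes "0 < n" "d \<le> n"
  shows "card {s \<in> sparse_necklaces (2 * n). gap s c \<and> (\<forall>r<d. \<not> gap s (c + 2 * int r + 1))}
           = fib (2 * (n - d))" (is "card ?A = _")
    and "finite {s \<in> sparse_necklaces (2 * n). gap s c \<and> (\<forall>r<d. \<not> gap s (c + 2 * int r + 1))}"
proof -
  let ?p = "\<lambda>x::nat. even x \<and> x \<noteq> 0"
  let ?B = "{s \<in> sparse_necklaces (2 * n). \<forall>x<2 * d + 2. s (c + int x) = ?p x}"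
  have gap: "gap s c" if "\<forall>x<2 * d + 2. s (c + int x) = ?p x" for s
    using that[rule_format, of 0] that[rule_format, of 1] by (simp add: gap_def)
  have eq: "?A = ?B"
  proof (intro Collect_cong conj_cong refl)
    fix s assume s: "s \<in> sparse_necklaces (2 * n)"
    show "gap s c \<and> (\<forall>r<d. \<not> gap s (c + 2 * int r + 1)) \<longleftrightarrow>
      (\<forall>x<2 * d + 2. s (c + int x) = ?p x)"
      using gap[of s] gap_run_iff[OF s, of c d] by argo
  qed
  have "card ?B = fib (2 * (n - d)) \<and> finite ?B"
  \<comment> \<open>For \<open>d = n\<close> the window of length \<open>2 * d + 2\<close> exceeds
    the period. By \<open>next_odd_gap\<close> no word qualifies, in agreement with
    \<open>fib 0 = 0\<close>.\<close>
  proof (cases "d = n")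
    case True
    then have "?B = {}" unfolding eq[symmetric] using next_odd_gap[OF _ _ assms(1)] by blast
    then show ?thesis using True by (simp only: card.empty) simp
  next
    case False
    have "card ?B = fib (2 * n - (2 * d + 2) + 2)" "finite ?B"
      by (rule card_necklaces_prescribed[where p = ?p]; use assms False in simp)+
    moreover have "2 * n - (2 * d + 2) + 2 = 2 * (n - d)" using assms False by simp
    ultimately show ?thesis by metis
  qed
  then show "card ?A = fib (2 * (n - d))" "finite ?A" unfolding eq by auto
qed

lemma card_gap_run_left:
  assumes "0 < n" "d \<le> n"
  shows "card {s \<in> sparse_necklaces (2 * n). gap s c \<and> (\<forall>r<d. \<not> gap s (c - 2 * int r - 1))}
           = fib (2 * (n - d))" (is "card ?A = _")
    and "finite {s \<in> sparse_necklaces (2 * n). gap s c \<and> (\<forall>r<d. \<not> gap s (c - 2 * int r - 1))}"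
proof -
  let ?B = "{s \<in> sparse_necklaces (2 * n). gap s (- c) \<and> (\<forall>r<d. \<not> gap s (- c + 2 * int r + 1))}"
  \<comment> \<open>Reflection turns leftward runs into rightward ones. A gap occupies two
    positions, so the reflection that takes a gap at \<open>x\<close> to a gap at \<open>- x\<close>
    is \<open>1 - x\<close> on positions.\<close>
  define f :: "(int \<Rightarrow> bool) \<Rightarrow> int \<Rightarrow> bool" where "f s x = s (1 - x)" for s x
  have ff: "f (f s) = s" for s by (auto simp: f_def)
  have gap: "gap (f s) x = gap s (- x)" for s x by (auto simp: gap_def f_def algebra_simps)
  have f: "f s \<in> sparse_necklaces N" if "s \<in> sparse_necklaces N" for s N
  proof -
    have "s (1 - (x + int N)) = s (1 - x)" for x
      using necklace_mult[OF that, of "1 - x" "- 1"] by (simp add: algebra_simps)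
    moreover have "\<not> (s (1 - x) \<and> s (1 - (x + 1)))" for x
      using sparse_necklaceD[OF that, of "- x"] by (auto simp: algebra_simps)
    ultimately show ?thesis by (simp add: sparse_necklaces_def f_def)
  qed
  have bij: "bij_betw f ?A ?B"
    by (rule bij_betw_byWitness[where f' = f]) (auto simp: ff gap f algebra_simps)
  show "card ?A = fib (2 * (n - d))" "finite ?A"
    using bij_betw_same_card[OF bij] bij_betw_finite[OF bij] card_gap_run[OF assms, of "- c"]
    by simp_all
qed

section \<open>Forests of the cycle\<close>

text \<open>Vertices are indexed by all integers, so that walks in either direction pass the edge
  between \<open>n\<close> and 1 without a special case. The shifts by 1 choose the representatives
  1 to \<open>n\<close> instead of 0 to \<open>n - 1\<close>.\<close>

definition cvert :: "nat \<Rightarrow> int \<Rightarrow> nat" where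
  "cvert n k = nat ((k - 1) mod int n) + 1"

definition cedge :: "nat \<Rightarrow> int \<Rightarrow> nat set" where
  "cedge n k = {cvert n k, cvert n (k + 1)}"

text \<open>Position \<open>2 k\<close> of the word lies just before vertex \<open>k\<close>, and position \<open>2 k + 1\<close> between
  vertex \<open>k\<close> and the edge from \<open>k\<close> to \<open>k + 1\<close>.\<close>

definition forest_of :: "nat \<Rightarrow> (int \<Rightarrow> bool) \<Rightarrow> nat set set \<times> nat set" where
  "forest_of n s = ({cedge n k |k. \<not> gap s (2 * k + 1)}, {cvert n k |k. gap s (2 * k)})"

section \<open>Roots and components in terms of reachability\<close>

abbreviation adj :: "'a set set \<Rightarrow> ('a \<times> 'a) set" where
  "adj F \<equiv> {(u, v). {u, v} \<in> F}"

lemma spanning_rooted_forests_iff: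
  "(F, R) \<in> spanning_rooted_forests V E \<longleftrightarrow>
     F \<subseteq> E \<and> uacyclic F \<and> R \<subseteq> V \<and> (\<forall>u\<in>V. \<exists>!r. (u, r) \<in> (adj F)\<^sup>* \<and> r \<in> R)"
proof -
  have "(\<forall>T \<in> components V F. \<exists>!r. r \<in> T \<and> r \<in> R) \<longleftrightarrow>
        (\<forall>u\<in>V. \<exists>!r. (u, r) \<in> connected_rel V F \<and> r \<in> R)"
    by (simp add: components_def quotient_def)
  moreover have "(u, r) \<in> connected_rel V F \<and> r \<in> R \<longleftrightarrow> (u, r) \<in> (adj F)\<^sup>* \<and> r \<in> R"
    if "R \<subseteq> V" "u \<in> V" for u r
    using that by (auto simp: connected_rel_def)
  ultimately show ?thesis by (simp add: spanning_rooted_forests_def cong: conj_cong)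
qed

lemma sym_adj: "sym (adj F)"
  by (auto simp: sym_def insert_commute)

lemma adj_rtrancl_sym: "(u, v) \<in> (adj F)\<^sup>* \<Longrightarrow> (v, u) \<in> (adj F)\<^sup>*"
  by (rule symD[OF sym_rtrancl[OF sym_adj]])

lemma same_component_iff:
  assumes "u \<in> V" "v \<in> V"
  shows "(\<exists>T \<in> components V F. u \<in> T \<and> v \<in> T) \<longleftrightarrow> (u, v) \<in> (adj F)\<^sup>*"
proof
  assume "\<exists>T \<in> components V F. u \<in> T \<and> v \<in> T"
  then obtain w where "(w, u) \<in> (adj F)\<^sup>*" "(w, v) \<in> (adj F)\<^sup>*"
    by (auto simp: components_def quotient_def connected_rel_def)
  then show "(u, v) \<in> (adj F)\<^sup>*" by (blast intro: rtrancl_trans adj_rtrancl_sym)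
next
  assume "(u, v) \<in> (adj F)\<^sup>*"
  then have "u \<in> connected_rel V F `` {u}" "v \<in> connected_rel V F `` {u}"
    using assms by (auto simp: connected_rel_def)
  moreover have "connected_rel V F `` {u} \<in> components V F"
    using assms by (auto simp: components_def quotient_def)
  ultimately show "\<exists>T \<in> components V F. u \<in> T \<and> v \<in> T" by blast
qed

section \<open>Vertices and edges of the cycle, indexed modulo \<open>n\<close>\<close>

context
  fixes n :: nat
  assumes n3: "n \<ge> 3"
begin

lemma cvert_eq_iff: "cvert n k = cvert n l \<longleftrightarrow> int n dvd k - l"
proof -
  have "cvert n k = cvert n l \<longleftrightarrow> (k - 1) mod int n = (l - 1) mod int n"
    using n3 by (simp add: cvert_def eq_nat_nat_iff)
  also have "\<dots> \<longleftrightarrow> int n dvd k - l" by (simp add: mod_eq_dvd_iff)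
  finally show ?thesis .
qed

lemma cvert_add_eq_iff: "cvert n (k + d) = cvert n (l + d) \<longleftrightarrow> cvert n k = cvert n l"
  by (simp add: cvert_eq_iff)

lemma cvert_of_nat: "i \<in> {1..n} \<Longrightarrow> cvert n (int i) = i"
  by (auto simp: cvert_def)

lemma range_cvert: "range (cvert n) = {1..n}"
proof
  have "nat ((k - 1) mod int n) < n" for k using n3 by (simp add: nat_less_iff)
  then show "range (cvert n) \<subseteq> {1..n}" by (auto simp: cvert_def Suc_le_eq)
  show "{1..n} \<subseteq> range (cvert n)" by (metis cvert_of_nat rangeI subsetI)
qed

lemma cvert_in_verts: "cvert n k \<in> {1..n}"
  using range_cvert by blast

lemma cvert_neighbour: "{cvert n k, w} = cedge n l \<Longrightarrow>
    cvert n l = cvert n k \<and> w = cvert n (k + 1) \<or> cvert n l = cvert n (k - 1) \<and> w = cvert n (k - 1)"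
  using cvert_add_eq_iff[of l 1 k] cvert_add_eq_iff[of l 1 "k - 1"]
  by (auto simp: cedge_def doubleton_eq_iff)

lemma cedge_cong: "cvert n k = cvert n l \<Longrightarrow> cedge n k = cedge n l"
  using cvert_add_eq_iff[of k 1 l] by (simp add: cedge_def)

text \<open>If two edges agreed with opposite orientations, \<open>n\<close> would divide both
  \<open>k - l - 1\<close> and \<open>k - l + 1\<close>, hence 2, contrary to
  \<open>n >= 3\<close>.\<close>

lemma cedge_eq_iff: "cedge n k = cedge n l \<longleftrightarrow> cvert n k = cvert n l"
proof
  assume "cedge n k = cedge n l"
  then consider "cvert n k = cvert n l" | "cvert n k = cvert n (l + 1)" "cvert n (k + 1) = cvert n l"
    by (auto simp: cedge_def doubleton_eq_iff)
  then show "cvert n k = cvert n l"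
  proof cases
    case 2
    then have "int n dvd (k + 1 - l) - (k - (l + 1))" unfolding cvert_eq_iff by (rule dvd_diff[rotated])
    then have "int n dvd 2" by simp
    then show ?thesis using n3 zdvd_imp_le[of "int n" 2] by simp
  qed
qed (rule cedge_cong)

lemma cedge_of_nat:
  assumes "i \<in> {1..n}"
  shows "cedge n (int i) = (if i = n then {n, 1} else {i, i + 1})"
proof (cases "i = n")
  case True
  then show ?thesis using n3 cvert_of_nat[of n] by (simp add: cedge_def cvert_def)
next
  case False
  then show ?thesis using assms cvert_of_nat[of i] cvert_of_nat[of "i + 1"]
    by (simp add: cedge_def add.commute)
qed

lemma cycle_edges_eq: "cycle_edges n = range (cedge n)"
proof (intro equalityI subsetI)
  fix e assume "e \<in> cycle_edges n"
  then consider k where "1 \<le> k" "k < n" "e = {k, k + 1}" | "e = {n, 1}"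
    unfolding cycle_edges_def by blast
  then show "e \<in> range (cedge n)"
  proof cases
    case (1 k)
    then have "e = cedge n (int k)" using cedge_of_nat[of k] by simp
    then show ?thesis by (rule range_eqI)
  next
    case 2
    then have "e = cedge n (int n)" using cedge_of_nat[of n] n3 by simp
    then show ?thesis by (rule range_eqI)
  qed
next
  fix e assume "e \<in> range (cedge n)"
  then obtain k where e: "e = cedge n k" by (rule rangeE)
  have "cvert n k = cvert n (int (cvert n k))" by (rule cvert_of_nat[OF cvert_in_verts, symmetric])
  then have e': "e = cedge n (int (cvert n k))" unfolding e by (rule cedge_cong)
  show "e \<in> cycle_edges n"
  proof (cases "cvert n k = n")
    case True
    then show ?thesis unfolding e' cedge_of_nat[OF cvert_in_verts] by (simp add: cycle_edges_def)
  next
    case False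
    moreover have "1 \<le> cvert n k" "cvert n k \<le> n" using cvert_in_verts[of k] by simp_all
    ultimately show ?thesis unfolding e' cedge_of_nat[OF cvert_in_verts] cycle_edges_def
      by (simp only: if_False) (rule UnI1, rule CollectI, rule exI[of _ "cvert n k"], simp)
  qed
qed

lemma cycle_edge_index: "F \<subseteq> cycle_edges n \<Longrightarrow> e \<in> F \<Longrightarrow> \<exists>l. e = cedge n l"
  using subsetD[of F "cycle_edges n" e] unfolding cycle_edges_eq by (simp add: image_iff)

section \<open>Acyclic subgraphs of the cycle\<close>

lemma not_uacyclic_cycle: "\<not> uacyclic (cycle_edges n)"
proof -
  have "{[1..<n + 1] ! k, [1..<n + 1] ! (Suc k mod n)} \<in> cycle_edges n" if "k < n" for k
  proof (cases "Suc k = n")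
    case True
    then show ?thesis using that by (simp add: cycle_edges_def del: upt_Suc)
  next
    case False
    then have "Suc k < n" using that by simp
    then show ?thesis by (auto simp: cycle_edges_def simp del: upt_Suc)
  qed
  then have "ucycle (cycle_edges n) [1..<n + 1]"
    using n3 by (simp add: ucycle_def del: upt_Suc)
  then show ?thesis by (auto simp: uacyclic_def)
qed

text \<open>Deleting the edge \<open>k\<close> leaves a path. On a cycle, the vertex farthest along the path would have
  both of its neighbours at the same place one step earlier.\<close>

lemma uacyclic_proper_subset:
  assumes F: "F \<subseteq> cycle_edges n" and k: "cedge n k \<notin> F"
  shows "uacyclic F"
proof (rule ccontr)
  assume "\<not> uacyclic F"
  then obtain xs where xs: "3 \<le> length xs" "distinct xs"
    and edge: "\<And>q. q < length xs \<Longrightarrow> {xs ! q, xs ! (Suc q mod length xs)} \<in> F"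
    by (auto simp: uacyclic_def ucycle_def)
  define L where "L = length xs"
  \<comment> \<open>The distance of a vertex from vertex \<open>k + 1\<close>, the first one on the
    path that remains after edge \<open>k\<close> is deleted.\<close>
  define pos :: "nat \<Rightarrow> int" where "pos u = (int u - (k + 1)) mod int n" for u
  have pos_cvert: "pos (cvert n l) = (l - (k + 1)) mod int n" for l
  proof -
    have "cvert n (int (cvert n l)) = cvert n l" by (rule cvert_of_nat[OF cvert_in_verts])
    then show ?thesis by (simp add: cvert_eq_iff pos_def mod_eq_dvd_iff)
  qed
  have pos_edge: "pos (cvert n (l + 1)) = pos (cvert n l) + 1" if "cedge n l \<in> F" for l
  proof -
    define t where "t = (l - (k + 1)) mod int n"
    \<comment> \<open>Positions do not wrap round along an edge of \<open>F\<close>: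
      \<open>t + 1 = n\<close> would make edge \<open>l\<close> the deleted edge
      \<open>k\<close>.\<close>
    have "cvert n l \<noteq> cvert n k" using that k cedge_cong by metis
    then have "\<not> int n dvd t + 1" unfolding t_def cvert_eq_iff
      by (simp add: dvd_eq_mod_eq_0 mod_add_left_eq)
    then have "t + 1 \<noteq> int n" by auto
    moreover have "0 \<le> t" "t < int n" using n3 by (auto simp: t_def)
    ultimately have "(t + 1) mod int n = t + 1" by simp
    moreover have "(l + 1 - (k + 1)) mod int n = (t + 1) mod int n"
      unfolding t_def mod_add_left_eq by (simp add: algebra_simps)
    ultimately show ?thesis by (simp add: pos_cvert t_def)
  qed
  have pos_adj: "\<bar>pos u - pos w\<bar> = 1" and in_verts: "u \<in> {1..n}" if "{u, w} \<in> F" for u w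
  proof -
    obtain l where l: "{u, w} = cedge n l" using cycle_edge_index[OF F \<open>{u, w} \<in> F\<close>] ..
    then have "cedge n l \<in> F" using that by simp
    from pos_edge[OF this] l show "\<bar>pos u - pos w\<bar> = 1"
      by (auto simp: cedge_def doubleton_eq_iff)
    show "u \<in> {1..n}" using l cvert_in_verts by (auto simp: cedge_def doubleton_eq_iff)
  qed
  have pos_inj: "u = w" if "u \<in> {1..n}" "w \<in> {1..n}" "pos u = pos w" for u w
    using that cvert_of_nat[of u] cvert_of_nat[of w] cvert_eq_iff[of "int u" "int w"]
    by (simp add: pos_def mod_eq_dvd_iff)
  have L: "3 \<le> L" using xs L_def by simp
  let ?P = "(\<lambda>q. pos (xs ! q)) ` {..<L}"
  have "0 \<in> {..<L}" using L by simp
  then have "Max ?P \<in> ?P" by (intro Max_in) blast+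
  then obtain q where q: "q < L" "Max ?P = pos (xs ! q)" by auto
  then have max: "pos (xs ! r) \<le> pos (xs ! q)" if "r < L" for r
    using that by (metis Max_ge finite_imageI finite_lessThan imageI lessThan_iff)
  \<comment> \<open>The successor and the predecessor of \<open>q\<close> on the closed list; they
    differ because the list has at least three entries. Both positions are one off the maximum,
    hence equal.\<close>
  define a b where "a = Suc q mod L" and "b = (if q = 0 then L - 1 else q - 1)"
  have ab: "a < L" "b < L" "Suc b mod L = q" "a \<noteq> b"
    using L q(1) by (auto simp: a_def b_def mod_Suc)
  have ea: "{xs ! q, xs ! a} \<in> F" using edge q(1) by (simp add: a_def L_def)
  have eb: "{xs ! b, xs ! q} \<in> F" using edge[of b] ab by (simp add: L_def)
  have "pos (xs ! a) = pos (xs ! b)"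
    using pos_adj[OF ea] pos_adj[OF eb] max[OF ab(1)] max[OF ab(2)] by linarith
  moreover have "xs ! a \<in> {1..n}" using ea in_verts by (metis insert_commute)
  moreover have "xs ! b \<in> {1..n}" using eb in_verts by blast
  ultimately have "xs ! a = xs ! b" using pos_inj by blast
  then show False using xs(2) ab by (simp add: nth_eq_iff_index_eq L_def)
qed

lemma uacyclic_iff:
  assumes "F \<subseteq> cycle_edges n"
  shows "uacyclic F \<longleftrightarrow> (\<exists>k. cedge n k \<notin> F)"
proof
  assume "uacyclic F"
  show "\<exists>k. cedge n k \<notin> F"
  proof (rule ccontr)
    assume "\<not> ?thesis"
    then have "range (cedge n) \<subseteq> F" by blast
    with assms have "F = cycle_edges n" unfolding cycle_edges_eq by (rule equalityI)
    with \<open>uacyclic F\<close> show False using not_uacyclic_cycle by simp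
  qed
qed (use uacyclic_proper_subset[OF assms] in blast)

section \<open>Connectivity along arcs\<close>

lemma connected_walk_right:
  "\<forall>r<m. cedge n (k + int r) \<in> F \<Longrightarrow> (cvert n k, cvert n (k + int m)) \<in> (adj F)\<^sup>*"
proof (induction m)
  case (Suc m)
  then have "(cvert n (k + int m), cvert n (k + int (Suc m))) \<in> adj F"
    by (simp add: cedge_def algebra_simps)
  with Suc show ?case by (meson less_SucI rtrancl.rtrancl_into_rtrancl)
qed simp

lemma connected_walk_left:
  assumes "\<forall>r<m. cedge n (k - 1 - int r) \<in> F"
  shows "(cvert n k, cvert n (k - int m)) \<in> (adj F)\<^sup>*"
proof -
  have "cedge n (k - int m + int r) \<in> F" if "r < m" for r
    using assms[rule_format, of "m - 1 - r"] that by (simp add: of_nat_diff algebra_simps)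
  then show ?thesis
    using connected_walk_right[of m "k - int m" F] by (auto intro: adj_rtrancl_sym)
qed

text \<open>Every walk can be straightened: a step against the current direction shortens a walk of
  positive length, and at length 0 it starts a walk in the other direction. The length
  \<open>m\<close> may exceed \<open>n\<close>.\<close>

lemma connected_iff:
  assumes F: "F \<subseteq> cycle_edges n"
  shows "(cvert n k, u) \<in> (adj F)\<^sup>* \<longleftrightarrow>
    (\<exists>m. u = cvert n (k + int m) \<and> (\<forall>r<m. cedge n (k + int r) \<in> F)) \<or>
    (\<exists>m. u = cvert n (k - int m) \<and> (\<forall>r<m. cedge n (k - 1 - int r) \<in> F))"
    (is "_ \<longleftrightarrow> ?right u \<or> ?left u")
proof
  assume "(cvert n k, u) \<in> (adj F)\<^sup>*"
  then show "?right u \<or> ?left u"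
  proof (induction rule: rtrancl_induct)
    case base
    have "?right (cvert n k)" by (rule exI[of _ 0]) simp
    then show ?case ..
  next
    case (step u w)
    have step_cases: "w = cvert n (l + 1) \<and> cedge n l \<in> F \<or> w = cvert n (l - 1) \<and> cedge n (l - 1) \<in> F"
      if "u = cvert n l" for l
    proof -
      obtain q where q: "{u, w} = cedge n q" using cycle_edge_index[OF F, of "{u, w}"] step(2) by auto
      then have "cedge n q \<in> F" using step(2) by simp
      then show ?thesis using cvert_neighbour[of l w q] q that cedge_cong by metis
    qed
    from step.IH show ?case
    proof
      assume "?right u"
      then obtain m where m: "u = cvert n (k + int m)" "\<forall>r<m. cedge n (k + int r) \<in> F" by blast
      from step_cases[OF m(1)] show ?thesis
      proof
        assume "w = cvert n (k + int m + 1) \<and> cedge n (k + int m) \<in> F"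
        then have "?right w" using m by (intro exI[of _ "Suc m"]) (auto simp: less_Suc_eq algebra_simps)
        then show ?thesis ..
      next
        assume w: "w = cvert n (k + int m - 1) \<and> cedge n (k + int m - 1) \<in> F"
        show ?thesis
        proof (cases m)
          case 0
          then have "?left w" using w by (intro exI[of _ 1]) auto
          then show ?thesis ..
        next
          case (Suc m')
          then have "?right w" using w m by (intro exI[of _ m']) auto
          then show ?thesis ..
        qed
      qed
    next
      assume "?left u"
      then obtain m where m: "u = cvert n (k - int m)" "\<forall>r<m. cedge n (k - 1 - int r) \<in> F" by blast
      from step_cases[OF m(1)] show ?thesis
      proof
        assume "w = cvert n (k - int m - 1) \<and> cedge n (k - int m - 1) \<in> F"
        then have "?left w" using m by (intro exI[of _ "Suc m"]) (auto simp: less_Suc_eq algebra_simps)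
        then show ?thesis ..
      next
        assume w: "w = cvert n (k - int m + 1) \<and> cedge n (k - int m) \<in> F"
        show ?thesis
        proof (cases m)
          case 0
          then have "?right w" using w by (intro exI[of _ 1]) auto
          then show ?thesis ..
        next
          case (Suc m')
          then have "?left w" using w m by (intro exI[of _ m']) auto
          then show ?thesis ..
        qed
      qed
    qed
  qed
qed (auto intro: connected_walk_right connected_walk_left)

text \<open>The length of a straight walk to the target is determined modulo \<open>n\<close>, so a
  rightward walk covers at least the arc of \<open>d\<close> edges and, for positive
  \<open>d\<close>, a leftward walk at least the other \<open>n - d\<close> edges.\<close>

lemma connected_arc_iff:
  assumes F: "F \<subseteq> cycle_edges n" and d: "d < n"
  shows "(cvert n k, cvert n (k + int d)) \<in> (adj F)\<^sup>* \<longleftrightarrow>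
    (\<forall>r<d. cedge n (k + int r) \<in> F) \<or> (\<forall>r<n - d. cedge n (k - 1 - int r) \<in> F)"
    (is "?L \<longleftrightarrow> ?right \<or> ?left")
proof
  assume ?L
  then show "?right \<or> ?left" unfolding connected_iff[OF F]
  proof (elim disjE exE conjE)
    fix m assume m: "cvert n (k + int d) = cvert n (k + int m)" "\<forall>r<m. cedge n (k + int r) \<in> F"
    have "d \<le> m"
    proof (rule ccontr)
      assume "\<not> d \<le> m"
      then have "int n dvd int d - int m" "0 < int d - int m" using m(1) by (auto simp: cvert_eq_iff)
      then show False using zdvd_imp_le d by fastforce
    qed
    then show ?thesis using m by auto
  next
    fix m assume m: "cvert n (k + int d) = cvert n (k - int m)" "\<forall>r<m. cedge n (k - 1 - int r) \<in> F"
    show ?thesis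
    \<comment> \<open>For \<open>d = 0\<close> the leftward walk may be empty, but then the
      rightward arc is empty too and the claim is trivial.\<close>
    proof (cases "d = 0")
      case False
      have "int n dvd int d + int m" "0 < int d + int m" using m(1) False by (auto simp: cvert_eq_iff)
      then have "n - d \<le> m" using zdvd_imp_le by fastforce
      then show ?thesis using m by auto
    qed simp
  qed
next
  have eq: "cvert n (k - int (n - d)) = cvert n (k + int d)"
    using d by (auto simp: cvert_eq_iff of_nat_diff)
  assume "?right \<or> ?left"
  then show ?L
    using connected_walk_right[of d k F] connected_walk_left[of "n - d" k F] unfolding eq by blast
qed

section \<open>The correspondence between words and forests\<close>

lemma gap_cvert_cong:
  assumes s: "s \<in> sparse_necklaces (2 * n)" and "cvert n k = cvert n l"
  shows "gap s (2 * k + c) = gap s (2 * l + c)"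
proof -
  obtain q where "k - l = int n * q" using assms(2) by (auto simp: cvert_eq_iff)
  then have k: "k = l + int n * q" by simp
  have "s (2 * k + x) = s (2 * l + x)" for x
    using necklace_mult[OF s, of "2 * l + x" q] unfolding k by (simp add: algebra_simps)
  from this[of c] this[of "c + 1"] show ?thesis by (simp add: gap_def add.assoc)
qed

text \<open>An edge has many indices. By periodicity the word has a gap at all of them or at none,
  so the existential in \<open>forest_of\<close> can be tested at any single index.\<close>

lemma cedge_in_forest_of:
  assumes "s \<in> sparse_necklaces (2 * n)"
  shows "cedge n k \<in> fst (forest_of n s) \<longleftrightarrow> \<not> gap s (2 * k + 1)"
proof
  assume "cedge n k \<in> fst (forest_of n s)"
  then obtain l where l: "cedge n k = cedge n l" "\<not> gap s (2 * l + 1)"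
    unfolding forest_of_def fst_conv by blast
  then show "\<not> gap s (2 * k + 1)" using gap_cvert_cong[OF assms, of k l 1] cedge_eq_iff by blast
next
  assume "\<not> gap s (2 * k + 1)"
  then show "cedge n k \<in> fst (forest_of n s)" unfolding forest_of_def fst_conv by blast
qed

lemma cvert_in_forest_of:
  assumes "s \<in> sparse_necklaces (2 * n)"
  shows "cvert n k \<in> snd (forest_of n s) \<longleftrightarrow> gap s (2 * k)"
proof
  assume "cvert n k \<in> snd (forest_of n s)"
  then obtain l where l: "cvert n k = cvert n l" "gap s (2 * l)"
    unfolding forest_of_def snd_conv by blast
  then show "gap s (2 * k)" using gap_cvert_cong[OF assms, of k l 0] by simp
next
  assume "gap s (2 * k)"
  then show "cvert n k \<in> snd (forest_of n s)" unfolding forest_of_def snd_conv by blast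
qed

lemma forest_of_in_forests:
  assumes "s \<in> gapped_necklaces (2 * n)"
  shows "forest_of n s \<in> spanning_rooted_forests (cycle_verts n) (cycle_edges n)"
proof -
  define F R where "F = fst (forest_of n s)" and "R = snd (forest_of n s)"
  have s: "s \<in> sparse_necklaces (2 * n)" and "\<exists>x. gap s x"
    using assms by (auto simp: gapped_necklaces_def)
  then obtain x where x: "gap s x" by blast
  from next_odd_gap[OF s x] n3 obtain r where y: "gap s (x + 2 * int r + 1)" by auto
  define y where "y = x + 2 * int r + 1"
  \<comment> \<open>Gaps of both parities occur, so there are a deleted edge \<open>k0\<close> and a
    root \<open>l0\<close>.\<close>
  have "even x \<noteq> even y" by (simp add: y_def)
  then obtain k0 l0 where k0: "gap s (2 * k0 + 1)" and l0: "gap s (2 * l0)"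
    using x y unfolding y_def[symmetric] by (metis evenE oddE)
  have edge: "cedge n k \<in> F \<longleftrightarrow> \<not> gap s (2 * k + 1)"
    and root: "cvert n k \<in> R \<longleftrightarrow> gap s (2 * k)" for k
    using cedge_in_forest_of[OF s] cvert_in_forest_of[OF s] by (auto simp: F_def R_def)
  have F: "F \<subseteq> cycle_edges n" by (auto simp: F_def forest_of_def cycle_edges_eq)
  have R: "R \<subseteq> cycle_verts n" using cvert_in_verts
    by (auto simp: R_def forest_of_def cycle_verts_def)
  have "uacyclic F" using uacyclic_iff[OF F] k0 edge by blast
  moreover have "\<exists>!r. (cvert n k, r) \<in> (adj F)\<^sup>* \<and> r \<in> R" for k
  proof (rule ex_ex1I)
    show "\<exists>r. (cvert n k, r) \<in> (adj F)\<^sup>* \<and> r \<in> R"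
    \<comment> \<open>The letter just after vertex \<open>k\<close> tells where its root lies: to
      the right for a one, at \<open>k\<close> or to the left for a zero. The root is the first
      vertex in that direction whose letter behind it (rightwards) or before it (leftwards) is a
      zero; the ones passed on the way keep the edges in \<open>F\<close>.\<close>
    proof (cases "s (2 * k + 1)")
      case True
      define P where "P m \<longleftrightarrow> \<not> s (2 * (k + int m) + 1)" for m
      define m where "m = (LEAST m. P m)"
      have "cvert n (k + (l0 - k) mod int n) = cvert n l0"
        unfolding cvert_eq_iff by (simp add: mod_eq_dvd_iff[symmetric] mod_add_right_eq)
      then have "gap s (2 * (k + (l0 - k) mod int n))"
        using gap_cvert_cong[OF s, of _ l0 0] l0 by (simp only: add_0_right)
      then have "P (nat ((l0 - k) mod int n))" using n3 by (simp add: P_def gap_def)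
      then have Pm: "P m" unfolding m_def by (rule LeastI)
      have run: "s (2 * (k + int r) + 1)" if "r < m" for r
        using not_less_Least[of r P] that by (simp add: P_def m_def)
      from Pm True obtain m' where m': "m = Suc m'" by (cases m) (auto simp: P_def)
      have "\<not> s (2 * (k + int m))"
        using sparse_necklaceD[OF s run[of m']] by (simp add: m' algebra_simps)
      then have "cvert n (k + int m) \<in> R" using Pm by (simp add: root gap_def P_def)
      moreover have "\<forall>r<m. cedge n (k + int r) \<in> F" using run by (simp add: edge gap_def)
      ultimately show ?thesis using connected_walk_right by blast
    next
      case False
      define P where "P m \<longleftrightarrow> \<not> s (2 * (k - int m))" for m
      define m where "m = (LEAST m. P m)"
      have "cvert n (k - (k - l0) mod int n) = cvert n l0"
        unfolding cvert_eq_iff by (simp add: mod_eq_dvd_iff[symmetric] mod_diff_right_eq)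
      then have "gap s (2 * (k - (k - l0) mod int n))"
        using gap_cvert_cong[OF s, of _ l0 0] l0 by (simp only: add_0_right)
      then have "P (nat ((k - l0) mod int n))" using n3 by (simp add: P_def gap_def)
      then have Pm: "P m" unfolding m_def by (rule LeastI)
      have run: "s (2 * (k - int r))" if "r < m" for r
        using not_less_Least[of r P] that by (simp add: P_def m_def)
      have "\<not> s (2 * (k - int m) + 1)"
      proof (cases m)
        case (Suc m')
        then show ?thesis using run[of m'] sparse_necklaceD[OF s, of "2 * (k - int m) + 1"]
          by (auto simp: algebra_simps)
      qed (use False in simp)
      then have "cvert n (k - int m) \<in> R" using Pm by (simp add: root gap_def P_def)
      moreover have "\<forall>r<m. cedge n (k - 1 - int r) \<in> F"
        using run by (auto simp: edge gap_def algebra_simps)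
      ultimately show ?thesis using connected_walk_left by blast
    qed
  next
    fix u w
    assume u: "(cvert n k, u) \<in> (adj F)\<^sup>* \<and> u \<in> R" and w: "(cvert n k, w) \<in> (adj F)\<^sup>* \<and> w \<in> R"
    \<comment> \<open>By \<open>gap_run_iff\<close>, unbroken edges after a root put a one before
      every later vertex of the run, so none of these is a root.\<close>
    have no_run: "m = 0"
      if "gap s (2 * p)" "gap s (2 * (p + int m))" "\<forall>r<m. cedge n (p + int r) \<in> F" for p m
    proof -
      have "\<forall>r<m. \<not> gap s (2 * p + 2 * int r + 1)" using that(3) by (simp add: edge distrib_left)
      then have "\<forall>x<2 * m + 2. s (2 * p + int x) = (even x \<and> x \<noteq> 0)"
        using gap_run_iff[OF s that(1)] by blast
      from this[rule_format, of "2 * m"] show ?thesis using that(2) by (simp add: gap_def)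
    qed
    obtain p where p: "u = cvert n p" using u R range_cvert by (auto simp: cycle_verts_def)
    have "(u, w) \<in> (adj F)\<^sup>*" using u w by (blast intro: rtrancl_trans adj_rtrancl_sym)
    then show "u = w" unfolding p connected_iff[OF F]
    proof (elim disjE exE conjE)
      fix m assume "w = cvert n (p + int m)" "\<forall>r<m. cedge n (p + int r) \<in> F"
      then show "cvert n p = w" using no_run[of p m] u w p root by auto
    next
      fix m assume m: "w = cvert n (p - int m)" "\<forall>r<m. cedge n (p - 1 - int r) \<in> F"
      have "cedge n (p - int m + int r) \<in> F" if "r < m" for r
        using m(2)[rule_format, of "m - 1 - r"] that by (simp add: of_nat_diff algebra_simps)
      then show "cvert n p = w" using no_run[of "p - int m" m] u w p m root by auto
    qed
  qed
  ultimately have "(F, R) \<in> spanning_rooted_forests (cycle_verts n) (cycle_edges n)"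
    using F R unfolding spanning_rooted_forests_iff cycle_verts_def range_cvert[symmetric] by simp
  then show ?thesis by (simp add: F_def R_def)
qed

text \<open>The forest determines all gaps. From one gap, where the letter is zero, the word can be
  read onwards: a one is followed by a zero, and a zero by a zero exactly at a gap.\<close>

lemma inj_on_forest_of: "inj_on (forest_of n) (gapped_necklaces (2 * n))"
proof (rule inj_onI)
  fix s t
  assume st: "s \<in> gapped_necklaces (2 * n)" "t \<in> gapped_necklaces (2 * n)"
    and eq: "forest_of n s = forest_of n t"
  then have s: "s \<in> sparse_necklaces (2 * n)" and t: "t \<in> sparse_necklaces (2 * n)"
    by (auto simp: gapped_necklaces_def)
  have gap: "gap s x = gap t x" for x
    using cedge_in_forest_of[OF s, of "x div 2"] cedge_in_forest_of[OF t, of "x div 2"]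
      cvert_in_forest_of[OF s, of "x div 2"] cvert_in_forest_of[OF t, of "x div 2"] eq
    by (cases "even x") auto
  obtain x where x: "gap s x" using st by (auto simp: gapped_necklaces_def)
  have agree: "s (x + int m) = t (x + int m)" for m
  proof (induction m)
    case 0
    then show ?case using x gap[of x] by (simp add: gap_def)
  next
    case (Suc m)
    then show ?case
      using gap[of "x + int m"] sparse_necklaceD[OF s, of "x + int m"]
        sparse_necklaceD[OF t, of "x + int m"]
      by (auto simp: gap_def algebra_simps)
  qed
  show "s = t"
  proof
    fix y
    have "(y - x) mod int (2 * n) \<ge> 0" using n3 by simp
    then show "s y = t y"
      using agree[of "nat ((y - x) mod int (2 * n))"] necklace_mod[OF s, of x y] necklace_mod[OF t, of x y]
      by simp
  qed
qed

lemma forest_of_surj: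
  assumes FR: "(F, R) \<in> spanning_rooted_forests (cycle_verts n) (cycle_edges n)"
  shows "(F, R) \<in> forest_of n ` gapped_necklaces (2 * n)"
proof -
  have F: "F \<subseteq> cycle_edges n" and R: "R \<subseteq> range (cvert n)" and "uacyclic F"
    and uniq: "\<exists>!r. (cvert n k, r) \<in> (adj F)\<^sup>* \<and> r \<in> R" for k
    using FR unfolding spanning_rooted_forests_iff cycle_verts_def range_cvert[symmetric] by simp_all
  then obtain k0 where k0: "cedge n k0 \<notin> F" using uacyclic_iff[OF F] by blast
  \<comment> \<open>\<open>a k\<close>: the root of vertex \<open>k\<close> is \<open>k\<close> itself or is reached leftwards;
    \<open>b k\<close>: it is reached by at least one step leftwards.\<close>
  define a where "a k \<longleftrightarrow> (\<exists>m. cvert n (k - int m) \<in> R \<and> (\<forall>r<m. cedge n (k - 1 - int r) \<in> F))" for k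
  define b where "b k \<longleftrightarrow> cedge n (k - 1) \<in> F \<and> a (k - 1)" for k
  have a_root: "a k" if "cvert n k \<in> R" for k
    unfolding a_def by (rule exI[of _ 0]) (use that in simp)
  have b_step: "b k \<longleftrightarrow> (\<exists>m. cvert n (k - int (Suc m)) \<in> R \<and> (\<forall>r<Suc m. cedge n (k - 1 - int r) \<in> F))" for k
    unfolding a_def b_def All_less_Suc2 by (auto simp: algebra_simps)
  have a_iff: "a k \<longleftrightarrow> cvert n k \<in> R \<or> b k" for k
  proof
    assume "a k"
    then obtain m where m: "cvert n (k - int m) \<in> R" "\<forall>r<m. cedge n (k - 1 - int r) \<in> F"
      unfolding a_def by blast
    then show "cvert n k \<in> R \<or> b k" unfolding b_step by (cases m) auto
  next
    assume "cvert n k \<in> R \<or> b k"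
    then show "a k" using a_root[of k] unfolding b_step a_def by blast
  qed
  have root_not_b: "\<not> b k" if "cvert n k \<in> R" for k
  proof
    assume "b k"
    then obtain m where m: "cvert n (k - int (Suc m)) \<in> R" "\<forall>r<Suc m. cedge n (k - 1 - int r) \<in> F"
      unfolding b_step by blast
    then have "cvert n k = cvert n (k - int (Suc m))"
      using uniq[of k] that connected_walk_left[OF m(2)] by blast
    then have "n \<le> Suc m" unfolding cvert_eq_iff
      using zdvd_imp_le[of "int n" "int (Suc m)"] by simp
    \<comment> \<open>Two equal roots mean that the leftward walk has gone all the way round;
      \<open>q\<close> is the step at which it would cross the missing edge
      \<open>k0\<close>.\<close>
    define q where "q = (k - 1 - k0) mod int n"
    have q: "0 \<le> q" "q < int n" using n3 by (auto simp: q_def)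
    then have "nat q < Suc m" using \<open>n \<le> Suc m\<close> by linarith
    then have "cedge n (k - 1 - int (nat q)) \<in> F" using m(2) by blast
    moreover have "cvert n (k - 1 - q) = cvert n k0"
      unfolding cvert_eq_iff q_def by (simp add: mod_eq_dvd_iff[symmetric] mod_diff_right_eq)
    then have "cedge n (k - 1 - q) = cedge n k0" by (rule cedge_cong)
    ultimately show False using k0 q by simp
  qed
  \<comment> \<open>Without edge \<open>k\<close> no rightward walk can leave vertex
    \<open>k\<close>, so the root is reached leftwards.\<close>
  have cut_a: "a k" if "cedge n k \<notin> F" for k
  proof -
    obtain r where r: "(cvert n k, r) \<in> (adj F)\<^sup>*" "r \<in> R" using uniq[of k] by blast
    from r(1) show ?thesis unfolding connected_iff[OF F]
    proof (elim disjE exE conjE)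
      fix m assume m: "r = cvert n (k + int m)" "\<forall>r<m. cedge n (k + int r) \<in> F"
      then have "m = 0" using that by (metis add.right_neutral gr0I of_nat_0)
      then show ?thesis using a_root m r by simp
    next
      fix m assume "r = cvert n (k - int m)" "\<forall>r<m. cedge n (k - 1 - int r) \<in> F"
      then show ?thesis using r(2) unfolding a_def by blast
    qed
  qed
  \<comment> \<open>Two zeros around vertex \<open>k\<close> say \<open>a k\<close> without
    \<open>b k\<close>, so \<open>k\<close> is a root. Two zeros around edge \<open>k\<close> say
    \<open>a k\<close> without \<open>b (k + 1)\<close>, so the edge is missing.\<close>
  define s where "s x \<longleftrightarrow> (if even x then b (x div 2) else \<not> a (x div 2))" for x
  have s_even: "s (2 * k) = b k" and s_odd: "s (2 * k + 1) = (\<not> a k)" for k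
    by (simp_all add: s_def)
  have s_even2: "s (2 * k + 1 + 1) = b (k + 1)" for k
    using s_even[of "k + 1"] by (simp add: algebra_simps)
  have shift: "cvert n (k + int n) = cvert n k" for k by (simp add: cvert_eq_iff)
  have a_periodic: "a (k + int n) = a k" for k
  proof -
    have "cvert n (k + int n - x) = cvert n (k - x)" for x
      using shift[of "k - x"] by (simp add: algebra_simps)
    moreover from this have "cedge n (k + int n - 1 - x) = cedge n (k - 1 - x)" for x
      using cedge_cong by (metis diff_diff_add)
    ultimately show ?thesis by (simp add: a_def)
  qed
  have "b (k + int n) = b k" for k
    using cedge_cong[OF shift[of "k - 1"]] a_periodic[of "k - 1"] unfolding b_def
    by (simp add: algebra_simps)
  with a_periodic have "s (x + int (2 * n)) = s x" for x by (simp add: s_def add.commute[of "int n"])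
  moreover have "\<not> (s x \<and> s (x + 1))" for x
  proof (cases "even x")
    case True
    then obtain k where "x = 2 * k" by (rule evenE)
    then show ?thesis using s_even s_odd a_iff by auto
  next
    case False
    then obtain k where x: "x = 2 * k + 1" by (rule oddE)
    then show ?thesis using s_odd[of k] s_even2[of k] by (auto simp: b_def)
  qed
  moreover have gap_odd: "gap s (2 * k + 1) \<longleftrightarrow> cedge n k \<notin> F" for k
    using s_odd[of k] s_even2[of k] cut_a by (auto simp: gap_def b_def)
  ultimately have s_gapped: "s \<in> gapped_necklaces (2 * n)"
    using k0 by (auto simp: gapped_necklaces_def sparse_necklaces_def)
  have gap_even: "gap s (2 * k) \<longleftrightarrow> cvert n k \<in> R" for k
    using s_even s_odd root_not_b a_iff by (auto simp: gap_def)
  have "{cedge n k |k. \<not> cedge n k \<notin> F} = F" using cycle_edge_index[OF F] by blast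
  moreover have "{cvert n k |k. cvert n k \<in> R} = R" using R by blast
  ultimately have "forest_of n s = (F, R)" by (simp only: forest_of_def gap_odd gap_even)
  then show ?thesis using s_gapped by (metis imageI)
qed

lemma forests_eq:
  "spanning_rooted_forests (cycle_verts n) (cycle_edges n) = forest_of n ` gapped_necklaces (2 * n)"
  by (intro equalityI subrelI image_subsetI forest_of_in_forests forest_of_surj)

section \<open>Counting the forests\<close>

lemma num_forests_cycle:
  "num_forests (cycle_verts n) (cycle_edges n) + 2 = fib (2 * n + 1) + fib (2 * n - 1)"
  using card_gapped_necklaces[of "2 * n"] n3
  by (simp add: num_forests_def forests_eq card_image inj_on_forest_of)

text \<open>Here \<open>d\<close> is the rightward distance from \<open>i\<close> to
  \<open>j\<close>. The words in \<open>?A\<close> keep the rightward arc of \<open>d\<close> edges,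
  those in \<open>?B\<close> the leftward arc of \<open>n - d\<close> edges; not both arcs are kept,
  since some edge is deleted.\<close>

lemma num_forests_rooted_cycle:
  assumes i: "cvert n k = i" and j: "cvert n (k + int d) = j" and d: "d < n"
  shows "num_forests_rooted (cycle_verts n) (cycle_edges n) i j = fib (2 * (n - d)) + fib (2 * d)"
proof -
  let ?A = "{s \<in> sparse_necklaces (2 * n). gap s (2 * k) \<and> (\<forall>r<d. \<not> gap s (2 * k + 2 * int r + 1))}"
  let ?B = "{s \<in> sparse_necklaces (2 * n). gap s (2 * k) \<and> (\<forall>r<n - d. \<not> gap s (2 * k - 2 * int r - 1))}"
  define Q where "Q = (\<lambda>(F, R). \<exists>T \<in> components (cycle_verts n) F. i \<in> T \<and> j \<in> T \<and> i \<in> R)"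
  have Q_iff: "Q (forest_of n s) \<longleftrightarrow> s \<in> ?A \<union> ?B" if "s \<in> gapped_necklaces (2 * n)" for s
  proof -
    define F R where "F = fst (forest_of n s)" and "R = snd (forest_of n s)"
    have s: "s \<in> sparse_necklaces (2 * n)" using that by (simp add: gapped_necklaces_def)
    have F: "F \<subseteq> cycle_edges n" by (auto simp: F_def forest_of_def cycle_edges_eq)
    have "i \<in> cycle_verts n" "j \<in> cycle_verts n"
      using cvert_in_verts i j unfolding cycle_verts_def by metis+
    moreover have "Q (F, R) \<longleftrightarrow>
        (\<exists>T \<in> components (cycle_verts n) F. i \<in> T \<and> j \<in> T) \<and> i \<in> R" by (auto simp: Q_def)
    ultimately have "Q (F, R) \<longleftrightarrow> (i, j) \<in> (adj F)\<^sup>* \<and> i \<in> R"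
      by (simp only: same_component_iff)
    also have "(i, j) \<in> (adj F)\<^sup>* \<longleftrightarrow>
        (\<forall>r<d. cedge n (k + int r) \<in> F) \<or> (\<forall>r<n - d. cedge n (k - 1 - int r) \<in> F)"
      using connected_arc_iff[OF F d, of k] i j by simp
    also have "i \<in> R \<longleftrightarrow> gap s (2 * k)" using cvert_in_forest_of[OF s, of k] i by (simp add: R_def)
    finally have "Q (F, R) \<longleftrightarrow> ((\<forall>r<d. cedge n (k + int r) \<in> F) \<or>
        (\<forall>r<n - d. cedge n (k - 1 - int r) \<in> F)) \<and> gap s (2 * k)" .
    moreover have "cedge n (k + int r) \<in> F \<longleftrightarrow> \<not> gap s (2 * k + 2 * int r + 1)" for r
      using cedge_in_forest_of[OF s, of "k + int r"] by (simp add: F_def distrib_left)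
    moreover have "cedge n (k - 1 - int r) \<in> F \<longleftrightarrow> \<not> gap s (2 * k - 2 * int r - 1)" for r
      using cedge_in_forest_of[OF s, of "k - 1 - int r"] by (simp add: F_def algebra_simps)
    ultimately have "Q (F, R) \<longleftrightarrow> s \<in> ?A \<union> ?B" using s by (simp only: Un_iff mem_Collect_eq) blast
    then show ?thesis by (simp add: F_def R_def)
  qed
  have gapped: "?A \<union> ?B \<subseteq> gapped_necklaces (2 * n)" by (auto simp: gapped_necklaces_def)
  have "num_forests_rooted (cycle_verts n) (cycle_edges n) i j =
      card {x \<in> forest_of n ` gapped_necklaces (2 * n). Q x}"
    unfolding num_forests_rooted_def forests_eq Q_def by (rule arg_cong[where f = card]) auto
  also have "{x \<in> forest_of n ` gapped_necklaces (2 * n). Q x} =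
      forest_of n ` {s \<in> gapped_necklaces (2 * n). Q (forest_of n s)}" by blast
  also have "{s \<in> gapped_necklaces (2 * n). Q (forest_of n s)} = ?A \<union> ?B"
    using Q_iff gapped by blast
  also have "card (forest_of n ` (?A \<union> ?B)) = card (?A \<union> ?B)"
    by (rule card_image) (rule inj_on_subset[OF inj_on_forest_of gapped])
  also have "card (?A \<union> ?B) = card ?A + card ?B"
  proof (rule card_Un_disjoint)
    show "finite ?A" "finite ?B"
      using card_gap_run(2)[of n d "2 * k"] card_gap_run_left(2)[of n "n - d" "2 * k"] n3 d by simp_all
    show "?A \<inter> ?B = {}"
    proof (rule ccontr)
      assume "?A \<inter> ?B \<noteq> {}"
      then obtain s where s: "s \<in> sparse_necklaces (2 * n)" "gap s (2 * k)"
        and A: "\<forall>r<d. \<not> gap s (2 * k + 2 * int r + 1)"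
        and B: "\<forall>r<n - d. \<not> gap s (2 * k - 2 * int r - 1)" by blast
      from next_odd_gap[OF s] n3 obtain r where r: "r < n" "gap s (2 * k + 2 * int r + 1)" by auto
      then have "d \<le> r" using A not_le by blast
      \<comment> \<open>The edge reached after \<open>r\<close> rightward steps is the one reached
        after \<open>n - 1 - r\<close> leftward steps.\<close>
      then have "n - 1 - r < n - d" using r by linarith
      with B have "\<not> gap s (2 * k - 2 * int (n - 1 - r) - 1)" by blast
      moreover have "2 * k - 2 * int (n - 1 - r) - 1 = 2 * (k + int r - int n) + 1"
        using r by (simp add: of_nat_diff)
      moreover have "gap s (2 * (k + int r - int n) + 1) = gap s (2 * (k + int r) + 1)"
        by (rule gap_cvert_cong[OF s(1)]) (simp add: cvert_eq_iff)
      ultimately have "\<not> gap s (2 * (k + int r) + 1)" by metis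
      then show False using r by (simp add: distrib_left)
    qed
  qed
  also have "\<dots> = fib (2 * (n - d)) + fib (2 * d)"
    using card_gap_run(1)[of n d "2 * k"] card_gap_run_left(1)[of n "n - d" "2 * k"] n3 d by simp
  finally show ?thesis .
qed

end

theorem theorem2:
  fixes n :: nat
  assumes "n \<ge> 3"
  shows "int (num_forests (cycle_verts n) (cycle_edges n))
           = int (fib (2 * n - 1)) + int (fib (2 * n + 1)) - 2
         \<and> (\<forall>i \<in> {1..n}. \<forall>j \<in> {1..n}.
              num_forests_rooted (cycle_verts n) (cycle_edges n) i j
                = fib (2 * nat \<bar>int j - int i\<bar>) + fib (2 * n - 2 * nat \<bar>int j - int i\<bar>))"
proof (intro conjI ballI)
  show "int (num_forests (cycle_verts n) (cycle_edges n))
      = int (fib (2 * n - 1)) + int (fib (2 * n + 1)) - 2"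
    using num_forests_cycle[OF assms] by linarith
next
  fix i j assume i: "i \<in> {1..n}" and j: "j \<in> {1..n}"
  note vi = cvert_of_nat[OF assms i] and vj = cvert_of_nat[OF assms j]
  show "num_forests_rooted (cycle_verts n) (cycle_edges n) i j
      = fib (2 * nat \<bar>int j - int i\<bar>) + fib (2 * n - 2 * nat \<bar>int j - int i\<bar>)"
  proof (cases "i \<le> j")
    case True
    have "cvert n (int i + int (j - i)) = j" using vj True by (simp add: of_nat_diff)
    moreover have "j - i < n" using i j by auto
    ultimately have "num_forests_rooted (cycle_verts n) (cycle_edges n) i j
        = fib (2 * (n - (j - i))) + fib (2 * (j - i))"
      by (rule num_forests_rooted_cycle[OF assms vi])
    moreover have "nat \<bar>int j - int i\<bar> = j - i" using True by simp
    ultimately show ?thesis by (simp only: diff_mult_distrib2 add.commute)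
  next
    case False
    \<comment> \<open>For \<open>j < i\<close> the rightward distance from \<open>i\<close> to
      \<open>j\<close> is \<open>n - (i - j)\<close>, which swaps the two Fibonacci terms.\<close>
    have "cvert n (int i + int (n - (i - j))) = cvert n (int j)"
      unfolding cvert_eq_iff[OF assms] using False i by (simp add: of_nat_diff)
    then have "cvert n (int i + int (n - (i - j))) = j" using vj by simp
    moreover have "n - (i - j) < n" using False i by auto
    ultimately have "num_forests_rooted (cycle_verts n) (cycle_edges n) i j
        = fib (2 * (n - (n - (i - j)))) + fib (2 * (n - (i - j)))"
      by (rule num_forests_rooted_cycle[OF assms vi])
    moreover have "n - (n - (i - j)) = i - j" using i by auto
    moreover have "nat \<bar>int j - int i\<bar> = i - j" using False by simp
    ultimately show ?thesis by (simp only: diff_mult_distrib2)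
  qed
qed

end
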